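(* Let $h:\mathbb R^n\to\mathbb R$ be convex and continuously differentiable with $L_h$-Lipschitz continuous gradient, and assume that $\phi_h(x):=f(x)-h(x)+\frac{\sigma}{2}\|Ax-b\|^2$ is convex on $\mathbb R^n$. Assume $Q\succ0$ and $P-A^\top Q^{-1}A\succ0$, set $\mu_x:=\lambda_{\min}(P-A^\top Q^{-1}A)$, and assume $\mu_x>L_h/2$. Define $\mathcal S_\gamma:=(1+\gamma)\widehat{\mathcal T}_{\rm lin}-\gamma I$. Then $\mathcal S_\gamma$ is nonexpansive in the $\mathcal M$-metric, i.e. $\|\mathcal S_\gamma w-\mathcal S_\gamma w'\|_{\mathcal M}\le\|w-w'\|_{\mathcal M}$ for all $w,w'\in\mathbb R^n\times\mathbb R^m$, whenever $$-1<\gamma\le 1-\frac{L_h}{2\mu_x}.$$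
   Context: Setting: $A\in\mathbb R^{m\times n}$, $b\in\mathbb R^m$, $\sigma\ge0$; $f:\mathbb R^n\to\mathbb R$ is convex and continuously differentiable with Lipschitz continuous gradient; $g:\mathbb R^n\to(-\infty,+\infty]$ is proper, closed and convex; $P\in\mathbb R^{n\times n}$, $Q\in\mathbb R^{m\times m}$ are self-adjoint. Define $$\mathcal M=\begin{pmatrix} P & A^\top \\ A & Q \end{pmatrix},\qquad \mathcal B_h(x,y)=\begin{pmatrix} \nabla h(x) \\ 0 \end{pmatrix},$$ $$\mathcal A_h(x,y)=\begin{pmatrix} \partial g(x)+\nabla f(x)-\nabla h(x)-A^\top y+\sigma A^\top(Ax-b) \\ Ax-b \end{pmatrix}.$$ Under the assumptions of the claim $\mathcal M$ is positive definite and the preconditioned forward–backward map $$\widehat{\mathcal T}_{\rm lin}(w):=(\mathcal M+\mathcal A_h)^{-1}\bigl(\mathcal Mw-\mathcal B_h(w)\bigr)$$ is single-valued and everywhere defined on $\mathbb R^n\times\mathbb R^m$. Notation: $\|w\|_{\mathcal M}=\sqrt{\langle w,\mathcal Mw\rangle}$. *)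

theory Defs
  imports "HOL-Analysis.Analysis"
begin

definition gradient :: "('a::real_inner \<Rightarrow> real) \<Rightarrow> 'a \<Rightarrow> 'a" where
  "gradient f x = (THE D. GDERIV f x :> D)"

definition continuously_differentiable :: "('a::real_inner \<Rightarrow> real) \<Rightarrow> bool" where
  "continuously_differentiable f \<longleftrightarrow>
     (\<forall>x. f differentiable (at x)) \<and> continuous_on UNIV (gradient f)"

text \<open>
  Extended-real-valued convex functions: convexity and closedness are, as usual, convexity and
  closedness of the epigraph, which lives in the product with the (finite) real line. The library
  constant \<open>epigraph\<close> only covers real-valued functions.
\<close>

definition ereal_epigraph :: "('a \<Rightarrow> ereal) \<Rightarrow> ('a \<times> real) set" where
  "ereal_epigraph g = {(x, r). g x \<le> ereal r}"

definition proper_fun :: "('a \<Rightarrow> ereal) \<Rightarrow> bool" where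
  "proper_fun g \<longleftrightarrow> (\<forall>x. g x \<noteq> -\<infinity>) \<and> (\<exists>x. g x \<noteq> \<infinity>)"

definition closed_fun :: "('a::topological_space \<Rightarrow> ereal) \<Rightarrow> bool" where
  "closed_fun g \<longleftrightarrow> closed (ereal_epigraph g)"

definition convex_fun :: "('a::real_vector \<Rightarrow> ereal) \<Rightarrow> bool" where
  "convex_fun g \<longleftrightarrow> convex (ereal_epigraph g)"

text \<open>For proper \<open>g\<close> this is empty at points where \<open>g\<close> takes the value \<open>\<infinity>\<close>.\<close>

definition subdifferential :: "('a::real_inner \<Rightarrow> ereal) \<Rightarrow> 'a \<Rightarrow> 'a set" where
  "subdifferential g x = {v. \<forall>z. g x + ereal (v \<bullet> (z - x)) \<le> g z}"

definition pos_def :: "real ^ 'n ^ 'n \<Rightarrow> bool" where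
  "pos_def S \<longleftrightarrow> transpose S = S \<and> (\<forall>x. x \<noteq> 0 \<longrightarrow> x \<bullet> (S *v x) > 0)"

text \<open>The smallest real eigenvalue; it exists whenever \<open>S\<close> is symmetric.\<close>

definition lambda_min :: "real ^ 'n ^ 'n \<Rightarrow> real" where
  "lambda_min S = (LEAST l. \<exists>v. v \<noteq> 0 \<and> S *v v = l *\<^sub>R v)"

text \<open>The block operators act on the Euclidean product space of pairs \<open>(x, y)\<close>.\<close>

definition M_op :: "real ^ 'n ^ 'n \<Rightarrow> real ^ 'm ^ 'm \<Rightarrow> real ^ 'n ^ 'm
    \<Rightarrow> (real ^ 'n) \<times> (real ^ 'm) \<Rightarrow> (real ^ 'n) \<times> (real ^ 'm)" where
  "M_op P Q A = (\<lambda>(x, y). (P *v x + transpose A *v y, A *v x + Q *v y))"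

definition B_op :: "(real ^ 'n \<Rightarrow> real) \<Rightarrow> (real ^ 'n) \<times> (real ^ 'm) \<Rightarrow> (real ^ 'n) \<times> (real ^ 'm)" where
  "B_op h = (\<lambda>(x, y). (gradient h x, 0))"

definition A_op :: "real ^ 'n ^ 'm \<Rightarrow> real ^ 'm \<Rightarrow> real \<Rightarrow> (real ^ 'n \<Rightarrow> real)
    \<Rightarrow> (real ^ 'n \<Rightarrow> ereal) \<Rightarrow> (real ^ 'n \<Rightarrow> real)
    \<Rightarrow> (real ^ 'n) \<times> (real ^ 'm) \<Rightarrow> ((real ^ 'n) \<times> (real ^ 'm)) set" where
  "A_op A b \<sigma> f g h = (\<lambda>(x, y).
     {(v + gradient f x - gradient h x - transpose A *v y + \<sigma> *\<^sub>R (transpose A *v (A *v x - b)),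
       A *v x - b) | v. v \<in> subdifferential g x})"

definition setvalued_inverse :: "('a \<Rightarrow> 'b set) \<Rightarrow> 'b \<Rightarrow> 'a set" where
  "setvalued_inverse F u = {z. u \<in> F z}"

text \<open>
  The resolvent-type set below is a singleton for every \<open>w\<close> when \<open>Q\<close> and the Schur complement
  \<open>P - A\<^sup>T Q\<^sup>-\<^sup>1 A\<close> are positive definite, \<open>g\<close> is proper, closed and convex, and
  \<open>f - h + \<sigma>/2 \<parallel>A x - b\<parallel>\<^sup>2\<close> is convex and continuously differentiable; \<open>T_lin\<close> is then its only
  element.
\<close>

definition T_lin :: "real ^ 'n ^ 'n \<Rightarrow> real ^ 'm ^ 'm \<Rightarrow> real ^ 'n ^ 'm \<Rightarrow> real ^ 'm \<Rightarrow> real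
    \<Rightarrow> (real ^ 'n \<Rightarrow> real) \<Rightarrow> (real ^ 'n \<Rightarrow> ereal) \<Rightarrow> (real ^ 'n \<Rightarrow> real)
    \<Rightarrow> (real ^ 'n) \<times> (real ^ 'm) \<Rightarrow> (real ^ 'n) \<times> (real ^ 'm)" where
  "T_lin P Q A b \<sigma> f g h w =
     the_elem (setvalued_inverse (\<lambda>z. {M_op P Q A z + a | a. a \<in> A_op A b \<sigma> f g h z})
       (M_op P Q A w - B_op h w))"

definition S_relaxed :: "real \<Rightarrow> real ^ 'n ^ 'n \<Rightarrow> real ^ 'm ^ 'm \<Rightarrow> real ^ 'n ^ 'm \<Rightarrow> real ^ 'm
    \<Rightarrow> real \<Rightarrow> (real ^ 'n \<Rightarrow> real) \<Rightarrow> (real ^ 'n \<Rightarrow> ereal) \<Rightarrow> (real ^ 'n \<Rightarrow> real)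
    \<Rightarrow> (real ^ 'n) \<times> (real ^ 'm) \<Rightarrow> (real ^ 'n) \<times> (real ^ 'm)" where
  "S_relaxed \<gamma> P Q A b \<sigma> f g h w = (1 + \<gamma>) *\<^sub>R T_lin P Q A b \<sigma> f g h w - \<gamma> *\<^sub>R w"

definition M_norm :: "real ^ 'n ^ 'n \<Rightarrow> real ^ 'm ^ 'm \<Rightarrow> real ^ 'n ^ 'm
    \<Rightarrow> (real ^ 'n) \<times> (real ^ 'm) \<Rightarrow> real" where
  "M_norm P Q A w = sqrt (w \<bullet> M_op P Q A w)"

end

theory Submission
  imports Defs
begin

text \<open>
  The inclusion defining \<open>T_lin\<close> is block triangular: its first component is the optimality
  condition of a strongly convex problem in \<open>x\<close>, and \<open>y\<close> is then determined by the invertible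
  \<open>Q\<close>; so the resolvent is single-valued and total. For \<open>d = w - w'\<close> and
  \<open>e = d - (T w - T w')\<close>, monotonicity of \<open>\<partial>g\<close> and \<open>\<nabla>\<phi>\<^sub>h\<close> together with cocoercivity of
  \<open>\<nabla>h\<close> gives \<open>\<langle>d - e, M e\<rangle> \<ge> - L\<^sub>h / 4 * \<parallel>e\<^sub>x\<parallel>\<^sup>2\<close>, and the Schur complement bounds the right
  side below by \<open>- L\<^sub>h / (4 \<mu>\<^sub>x) * \<parallel>e\<parallel>\<^sub>M\<^sup>2\<close>. Expanding \<open>\<parallel>d - (1 + \<gamma>) e\<parallel>\<^sub>M\<^sup>2\<close> yields the claim.
\<close>

text \<open>As a simp rule it would rewrite \<open>transpose A *v y\<close> to a vector-matrix
  product and hide the form that \<open>dot_transpose_matrix\<close> matches.\<close>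

declare transpose_matrix_vector [simp del]

section \<open>Gradients, convexity and Lipschitz estimates\<close>

text \<open>\<open>gradient\<close> is a definite description: the Riesz vector
  \<open>adjoint f' 1\<close> gives existence, uniqueness of derivatives the rest.\<close>

lemma GDERIV_gradient:
  fixes f :: "'a::euclidean_space \<Rightarrow> real"
  assumes "f differentiable (at x)"
  shows "GDERIV f x :> gradient f x"
proof -
  obtain f' where f': "(f has_derivative f') (at x)"
    using assms by (auto simp: differentiable_def)
  have lin: "linear f'"
    using f' by (rule has_derivative_linear)
  define D where "D = adjoint f' 1"
  have "f' = (\<lambda>y. y \<bullet> D)"
    using adjoint_works[OF lin, of _ 1] by (simp add: D_def fun_eq_iff)
  then have D: "GDERIV f x :> D"
    using f' by (simp add: gderiv_def)
  have "E = D" if "GDERIV f x :> E" for E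
  proof -
    have "(\<lambda>y. y \<bullet> E) = (\<lambda>y. y \<bullet> D)"
      using that D unfolding gderiv_def by (rule has_derivative_unique)
    then show ?thesis
      by (metis inner_commute vector_eq_rdot)
  qed
  then show ?thesis
    unfolding gradient_def using D by (metis theI)
qed

text \<open>The limit is one-sided because the convexity arguments control difference quotients only
  for \<open>0 < t < 1\<close>.\<close>

lemma GDERIV_directional:
  assumes "GDERIV f x :> D"
  shows "((\<lambda>t. (f (x + t *\<^sub>R d) - f x) / t) \<longlongrightarrow> d \<bullet> D) (at_right 0)"
proof -
  have f': "(f has_derivative (\<lambda>y. y \<bullet> D)) (at (x + 0 *\<^sub>R d))"
    using assms by (simp add: gderiv_def)
  have "((\<lambda>t. x + t *\<^sub>R d) has_derivative (\<lambda>t. t *\<^sub>R d)) (at (0::real))"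
    by (auto intro!: derivative_eq_intros)
  from has_derivative_compose[OF this f']
  have "((\<lambda>t. f (x + t *\<^sub>R d)) has_derivative (\<lambda>t. t * (d \<bullet> D))) (at (0::real))"
    by simp
  then have "((\<lambda>t. f (x + t *\<^sub>R d)) has_field_derivative (d \<bullet> D)) (at 0)"
    by (simp add: has_field_derivative_def mult.commute[of _ "d \<bullet> D"])
  then have "((\<lambda>t. (f (x + t *\<^sub>R d) - f x) / t) \<longlongrightarrow> d \<bullet> D) (at 0)"
    by (simp add: has_field_derivative_iff)
  then show ?thesis
    by (rule filterlim_mono) (auto simp: at_within_le_at)
qed

lemma convex_on_GDERIV_above_tangent:
  assumes "convex_on UNIV f" and "GDERIV f x :> D"
  shows "f x + (z - x) \<bullet> D \<le> f z"
proof -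
  have "(f (x + t *\<^sub>R (z - x)) - f x) / t \<le> f z - f x" if "0 < t" "t < 1" for t :: real
  proof -
    have "f ((1 - t) *\<^sub>R x + t *\<^sub>R z) \<le> (1 - t) * f x + t * f z"
      using assms(1) that by (intro convex_onD) auto
    moreover have "(1 - t) *\<^sub>R x + t *\<^sub>R z = x + t *\<^sub>R (z - x)"
      by (simp add: algebra_simps)
    ultimately show ?thesis
      using that by (simp add: field_simps)
  qed
  then have "\<forall>\<^sub>F t in at_right 0. (f (x + t *\<^sub>R (z - x)) - f x) / t \<le> f z - f x"
    by (auto simp: eventually_at_right_field intro: exI[of _ 1])
  then have "(z - x) \<bullet> D \<le> f z - f x"
    using tendsto_upperbound[OF GDERIV_directional[OF assms(2)]] by auto
  then show ?thesis by simp
qed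

lemma GDERIV_convex_monotone:
  assumes "convex_on UNIV f" and "GDERIV f x :> D" and "GDERIV f y :> E"
  shows "(x - y) \<bullet> (D - E) \<ge> 0"
  using convex_on_GDERIV_above_tangent[OF assms(1,2), of y]
    convex_on_GDERIV_above_tangent[OF assms(1,3), of x]
  by (simp add: inner_diff_left inner_diff_right)

text \<open>Subtracting the quadratic upper model along the segment leaves \<open>F\<close>, whose
  derivative on \<open>[0, 1]\<close> is nonpositive by Cauchy-Schwarz and the Lipschitz
  bound.\<close>

lemma lipschitz_gradient_descent:
  assumes D: "\<And>x. GDERIV f x :> G x" and L: "L-lipschitz_on UNIV G"
  shows "f (x + d) \<le> f x + d \<bullet> G x + L / 2 * (d \<bullet> d)"
proof -
  define F where "F t = f (x + t *\<^sub>R d) - t * (d \<bullet> G x) - L / 2 * t\<^sup>2 * (d \<bullet> d)" for t :: real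
  have F': "(F has_real_derivative (d \<bullet> G (x + t *\<^sub>R d) - d \<bullet> G x - L * t * (d \<bullet> d))) (at t)" for t
  proof -
    have f': "(f has_derivative (\<lambda>y. y \<bullet> G (x + t *\<^sub>R d))) (at (x + t *\<^sub>R d))"
      using D by (simp add: gderiv_def)
    have "((\<lambda>t. x + t *\<^sub>R d) has_derivative (\<lambda>t. t *\<^sub>R d)) (at t)"
      by (auto intro!: derivative_eq_intros)
    from has_derivative_compose[OF this f']
    have "((\<lambda>t. f (x + t *\<^sub>R d)) has_field_derivative (d \<bullet> G (x + t *\<^sub>R d))) (at t)"
      by (simp add: has_field_derivative_def mult.commute[of _ "d \<bullet> G (x + t *\<^sub>R d)"])
    then show ?thesis
      unfolding F_def by (auto intro!: derivative_eq_intros simp: algebra_simps)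
  qed
  have "F 1 \<le> F 0"
  proof (rule DERIV_nonpos_imp_nonincreasing[where f = F])
    fix t :: real
    assume "0 \<le> t" "t \<le> 1"
    have "d \<bullet> (G (x + t *\<^sub>R d) - G x) \<le> norm d * norm (G (x + t *\<^sub>R d) - G x)"
      by (rule norm_cauchy_schwarz)
    also have "\<dots> \<le> norm d * (L * norm (t *\<^sub>R d))"
      using lipschitz_onD[OF L, of "x + t *\<^sub>R d" x]
      by (intro mult_left_mono) (auto simp: dist_norm)
    also have "\<dots> = L * t * (d \<bullet> d)"
      using \<open>0 \<le> t\<close> by (simp add: power2_norm_eq_inner[symmetric] power2_eq_square)
    finally show "\<exists>y. (F has_real_derivative y) (at t) \<and> y \<le> 0"
      using F'[of t] by (auto simp: inner_diff_right)
  qed simp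
  then show ?thesis
    by (simp add: F_def)
qed

text \<open>
  A division-free form of the Baillon--Haddad cocoercivity estimate, optimised over the
  perturbation \<open>e\<close>: compare the tangent at \<open>q\<close> with the quadratic upper bound at \<open>p\<close> in the
  point \<open>p - e / 2\<close>, and symmetrically in \<open>q + e / 2\<close>.
\<close>

lemma lipschitz_gradient_perturbed_monotone:
  assumes "convex_on UNIV f" and D: "\<And>x. GDERIV f x :> G x" and L: "L-lipschitz_on UNIV G"
  shows "(p - q - e) \<bullet> (G p - G q) \<ge> - (L / 4) * (e \<bullet> e)"
proof -
  have 1: "f q + (p + (- (1/2)) *\<^sub>R e - q) \<bullet> G q \<le> f p + ((- (1/2)) *\<^sub>R e) \<bullet> G p + L / 8 * (e \<bullet> e)"
    using convex_on_GDERIV_above_tangent[OF assms(1) D[of q], of "p + (- (1/2)) *\<^sub>R e"]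
      lipschitz_gradient_descent[OF D L, of p "(- (1/2)) *\<^sub>R e"] by simp
  have 2: "f p + (q + (1/2) *\<^sub>R e - p) \<bullet> G p \<le> f q + ((1/2) *\<^sub>R e) \<bullet> G q + L / 8 * (e \<bullet> e)"
    using convex_on_GDERIV_above_tangent[OF assms(1) D[of p], of "q + (1/2) *\<^sub>R e"]
      lipschitz_gradient_descent[OF D L, of q "(1/2) *\<^sub>R e"] by simp
  show ?thesis
    using 1 2 by (simp add: inner_diff_left inner_diff_right inner_add_left algebra_simps)
qed

section \<open>Subdifferentials and minimisation of extended-real-valued functions\<close>

lemma proper_subdifferential_finite:
  assumes "proper_fun g" and "v \<in> subdifferential g x"
  shows "\<bar>g x\<bar> \<noteq> \<infinity>"
proof -
  obtain z where "g z \<noteq> \<infinity>"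
    using assms(1) by (auto simp: proper_fun_def)
  moreover have "g x + ereal (v \<bullet> (z - x)) \<le> g z"
    using assms(2) by (auto simp: subdifferential_def)
  moreover have "g x \<noteq> - \<infinity>"
    using assms(1) by (auto simp: proper_fun_def)
  ultimately show ?thesis by auto
qed

lemma subdifferential_monotone:
  assumes "proper_fun g" and v: "v \<in> subdifferential g x" and w: "w \<in> subdifferential g y"
  shows "(x - y) \<bullet> (v - w) \<ge> 0"
proof -
  obtain a b where ab: "g x = ereal a" "g y = ereal b"
    using proper_subdifferential_finite[OF assms(1) v] proper_subdifferential_finite[OF assms(1) w]
    by (cases "g x"; cases "g y") auto
  have "a + v \<bullet> (y - x) \<le> b"
    using v ab by (auto simp: subdifferential_def dest: spec[of _ y])
  moreover have "b + w \<bullet> (x - y) \<le> a"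
    using w ab by (auto simp: subdifferential_def dest: spec[of _ x])
  ultimately show ?thesis
    by (simp add: inner_diff_left inner_diff_right inner_commute)
qed

text \<open>A hyperplane separates the epigraph from the point one unit below
  \<open>(x0, r0)\<close>. Since \<open>(x0, r0)\<close> lies on the other side, the vertical
  coefficient \<open>\<alpha>\<close> is positive and the hyperplane can be solved for
  \<open>r\<close>.\<close>

lemma proper_closed_convex_affine_minorant:
  fixes g :: "'a::euclidean_space \<Rightarrow> ereal"
  assumes "proper_fun g" "closed_fun g" "convex_fun g"
  shows "\<exists>p \<beta>. \<forall>x r. g x \<le> ereal r \<longrightarrow> \<beta> + p \<bullet> x \<le> r"
proof -
  obtain x0 where "g x0 \<noteq> \<infinity>" "g x0 \<noteq> - \<infinity>"
    using assms(1) by (auto simp: proper_fun_def)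
  then obtain r0 where r0: "g x0 = ereal r0"
    by (cases "g x0") auto
  have "(x0, r0 - 1) \<notin> ereal_epigraph g"
    using r0 by (simp add: ereal_epigraph_def)
  then obtain a b where ab: "a \<bullet> (x0, r0 - 1) < b" "\<forall>z\<in>ereal_epigraph g. a \<bullet> z > b"
    using separating_hyperplane_closed_point[of "ereal_epigraph g" "(x0, r0 - 1)"] assms(2,3)
    by (auto simp: closed_fun_def convex_fun_def)
  obtain q \<alpha> where a: "a = (q, \<alpha>)" by force
  have "(x0, r0) \<in> ereal_epigraph g"
    using r0 by (simp add: ereal_epigraph_def)
  then have "a \<bullet> (x0, r0) > b" using ab by blast
  then have \<alpha>: "\<alpha> > 0"
    using ab(1) by (simp add: a algebra_simps)
  have "b / \<alpha> + ((- 1 / \<alpha>) *\<^sub>R q) \<bullet> x \<le> r" if "g x \<le> ereal r" for x r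
  proof -
    have "q \<bullet> x + \<alpha> * r > b"
      using ab(2) that by (auto simp: ereal_epigraph_def a)
    then show ?thesis
      using \<alpha> by (simp add: field_simps)
  qed
  then show ?thesis by blast
qed

text \<open>Serves to bound a sublevel set. The summand 1 makes a counterexample exceed 1, so
  multiplying \<open>c * n - D > \<bar>V\<bar>\<close> by \<open>n\<close> preserves the
  bound.\<close>

lemma quadratic_growth_bound:
  fixes n c D V :: real
  assumes "c > 0" "D \<ge> 0" "c * n\<^sup>2 \<le> D * n + V"
  shows "n \<le> (D + \<bar>V\<bar>) / c + 1"
proof (rule ccontr)
  assume "\<not> ?thesis"
  then have n: "n > (D + \<bar>V\<bar>) / c + 1" by simp
  moreover have "(D + \<bar>V\<bar>) / c \<ge> 0" using assms by simp
  ultimately have "n > 1" by linarith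
  have "c * n - D > \<bar>V\<bar>"
    using n assms(1) by (simp add: field_simps)
  then have "n * (c * n - D) > 1 * \<bar>V\<bar>"
    using \<open>n > 1\<close> by (intro mult_strict_mono') auto
  then show False
    using assms(3) by (simp add: algebra_simps power2_eq_square)
qed

text \<open>
  The solution is the minimiser of \<open>g + \<psi>\<close>; it is found by minimising \<open>r + \<psi> x\<close> over the
  epigraph of \<open>g\<close>, which avoids semicontinuity of extended-real functions.
\<close>

lemma subdifferential_inclusion_solvable:
  fixes g :: "'a::euclidean_space \<Rightarrow> ereal"
  assumes g: "proper_fun g" "closed_fun g" "convex_fun g"
    and D: "\<And>x. GDERIV \<psi> x :> G x"
    and "c > 0" and growth: "\<And>x. c * (x \<bullet> x) + d \<bullet> x + k \<le> \<psi> x"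
  shows "\<exists>x. - G x \<in> subdifferential g x"
proof -
  let ?E = "ereal_epigraph g"
  have E: "(x, r) \<in> ?E \<longleftrightarrow> g x \<le> ereal r" for x r
    by (simp add: ereal_epigraph_def)
  obtain p \<beta> where minor: "\<And>x r. g x \<le> ereal r \<Longrightarrow> \<beta> + p \<bullet> x \<le> r"
    using proper_closed_convex_affine_minorant[OF g] by metis
  obtain x0 where "g x0 \<noteq> \<infinity>" "g x0 \<noteq> - \<infinity>"
    using g(1) by (auto simp: proper_fun_def)
  then obtain r0 where r0: "g x0 = ereal r0"
    by (cases "g x0") auto
  define J where "J z = snd z + \<psi> (fst z)" for z :: "'a \<times> real"
  have "isCont \<psi> x" for x
    using D has_derivative_continuous unfolding gderiv_def by blast
  then have "continuous_on UNIV \<psi>"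
    by (simp add: continuous_on_eq_continuous_at)
  then have "continuous_on S (\<lambda>z. \<psi> (fst z))" for S :: "('a \<times> real) set"
    by (rule continuous_on_compose2[OF _ continuous_on_fst[OF continuous_on_id]]) simp
  then have cont: "continuous_on S J" for S
    unfolding J_def by (intro continuous_on_add continuous_on_snd continuous_on_id)
  \<comment> \<open>This is the value of \<open>J\<close> at \<open>(x0, r0)\<close>, so the
    sublevel set \<open>C\<close> is nonempty.\<close>
  define V where "V = r0 + \<psi> x0"
  define C where "C = ?E \<inter> {z. J z \<le> V}"
  define R where "R = (norm (d + p) + \<bar>V - k - \<beta>\<bar>) / c + 1"
  \<comment> \<open>The minorant of \<open>g\<close> and the growth of \<open>\<psi>\<close> leave
    \<open>c * (norm x)\<^sup>2\<close> below an affine function of \<open>norm x\<close>, which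
    bounds \<open>x\<close>. Then the minorant bounds \<open>r\<close> from below and
    \<open>V - \<psi> x\<close> bounds it from above.\<close>
  have "C \<subseteq> cball 0 R \<times> {\<beta> - norm p * R .. V - k + norm d * R}"
  proof clarify
    fix x r
    assume "(x, r) \<in> C"
    then have gx: "g x \<le> ereal r" and J: "r + \<psi> x \<le> V"
      by (auto simp: C_def E J_def)
    have "c * (norm x)\<^sup>2 + (d + p) \<bullet> x \<le> V - k - \<beta>"
      using minor[OF gx] growth[of x] J by (simp add: power2_norm_eq_inner inner_add_left)
    moreover have "- ((d + p) \<bullet> x) \<le> norm (d + p) * norm x"
      using Cauchy_Schwarz_ineq2[of "d + p" x] by linarith
    ultimately have "norm x \<le> R"
      unfolding R_def using \<open>c > 0\<close> by (intro quadratic_growth_bound) auto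
    moreover have "- (norm p * R) \<le> p \<bullet> x"
      using Cauchy_Schwarz_ineq2[of p x] mult_left_mono[OF \<open>norm x \<le> R\<close>, of "norm p"] by auto
    moreover have "- (norm d * R) \<le> d \<bullet> x"
      using Cauchy_Schwarz_ineq2[of d x] mult_left_mono[OF \<open>norm x \<le> R\<close>, of "norm d"] by auto
    moreover have "c * (x \<bullet> x) \<ge> 0"
      using \<open>c > 0\<close> by simp
    ultimately show "x \<in> cball 0 R \<and> r \<in> {\<beta> - norm p * R .. V - k + norm d * R}"
      using minor[OF gx] growth[of x] J by auto
  qed
  then have "bounded C"
    by (rule bounded_subset[rotated]) (intro bounded_Times bounded_cball bounded_closed_interval)
  moreover have "closed C"
    unfolding C_def using g(2) cont
    by (intro closed_Int closed_Collect_le continuous_on_const) (auto simp: closed_fun_def)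
  ultimately have "compact C"
    by (simp add: compact_eq_bounded_closed)
  moreover have "(x0, r0) \<in> C"
    by (simp add: C_def E J_def V_def r0)
  ultimately obtain x r where xr: "(x, r) \<in> C" and Jmin: "\<forall>z\<in>C. J (x, r) \<le> J z"
    using continuous_attains_inf[of C J] cont by fastforce
  \<comment> \<open>Minimality over \<open>C\<close> extends to the whole epigraph, as
    \<open>J\<close> exceeds \<open>V\<close> at its points outside \<open>C\<close>.\<close>
  have min: "r + \<psi> x \<le> s + \<psi> z" if "g z \<le> ereal s" for z s
  proof (cases "J (z, s) \<le> V")
    case True
    then have "(z, s) \<in> C" using that by (simp add: C_def E)
    then show ?thesis using Jmin by (fastforce simp: J_def)
  next
    case False
    then show ?thesis using xr by (auto simp: C_def J_def)
  qed
  have gxr: "g x \<le> ereal r"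
    using xr by (auto simp: C_def E)
  have "- G x \<in> subdifferential g x"
    unfolding subdifferential_def
  proof clarify
    fix z
    show "g x + ereal (- G x \<bullet> (z - x)) \<le> g z"
    proof (cases "g z")
      case (real s)
      \<comment> \<open>Along the segment from \<open>(x, r)\<close> to \<open>(z, s)\<close> inside
        the epigraph, minimality weighs the linear change in height against the change in
        \<open>\<psi>\<close>.\<close>
      have "(\<psi> (x + t *\<^sub>R (z - x)) - \<psi> x) / t \<ge> r - s" if "0 < t" "t < 1" for t :: real
      proof -
        have "(1 - t) *\<^sub>R (x, r) + t *\<^sub>R (z, s) \<in> ?E"
          using g(3) that gxr real by (intro convexD) (auto simp: convex_fun_def E)
        then have "g (x + t *\<^sub>R (z - x)) \<le> ereal ((1 - t) * r + t * s)"
          by (simp add: E algebra_simps)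
        from min[OF this] show ?thesis
          using that by (simp add: field_simps)
      qed
      then have "\<forall>\<^sub>F t in at_right 0. (\<psi> (x + t *\<^sub>R (z - x)) - \<psi> x) / t \<ge> r - s"
        by (auto simp: eventually_at_right_field intro: exI[of _ 1])
      then have "(z - x) \<bullet> G x \<ge> r - s"
        using tendsto_lowerbound[OF GDERIV_directional[OF D[of x]]] by auto
      then have "ereal (r + - G x \<bullet> (z - x)) \<le> g z"
        by (simp add: real inner_commute)
      moreover have "g x + ereal (- G x \<bullet> (z - x)) \<le> ereal r + ereal (- G x \<bullet> (z - x))"
        using gxr by (rule add_right_mono)
      ultimately show ?thesis by simp
    next
      case MInf
      then show ?thesis using g(1) by (auto simp: proper_fun_def)
    qed simp
  qed
  then show ?thesis by blast
qed

section \<open>Symmetric matrices and the smallest eigenvalue\<close>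

lemma symmetric_dot_matrix:
  fixes S :: "real ^ 'n ^ 'n"
  assumes "transpose S = S"
  shows "x \<bullet> (S *v y) = y \<bullet> (S *v x)"
  by (metis assms dot_lmul_matrix inner_commute transpose_matrix_vector)

lemma dot_transpose_matrix:
  fixes A :: "real ^ 'n ^ 'm"
  shows "x \<bullet> (transpose A *v y) = y \<bullet> (A *v x)"
  by (metis dot_lmul_matrix inner_commute transpose_matrix_vector)

text \<open>At \<open>v - t *\<^sub>R (S *v v)\<close> the form has no constant term; unless
  \<open>S *v v = 0\<close>, its negative linear term wins for small \<open>t > 0\<close>.\<close>

lemma psd_form_zero_imp_kernel:
  fixes S :: "real ^ 'n ^ 'n"
  assumes sym: "transpose S = S" and psd: "\<And>x. x \<bullet> (S *v x) \<ge> 0" and "v \<bullet> (S *v v) = 0"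
  shows "S *v v = 0"
proof (rule ccontr)
  let ?u = "S *v v"
  assume "?u \<noteq> 0"
  then have pos: "?u \<bullet> ?u > 0" by simp
  define q where "q = ?u \<bullet> (S *v ?u)"
  have "q \<ge> 0" using psd by (simp add: q_def)
  have form: "2 * t * (?u \<bullet> ?u) \<le> t\<^sup>2 * q" for t
  proof -
    have "(v - t *\<^sub>R ?u) \<bullet> (S *v (v - t *\<^sub>R ?u)) = t\<^sup>2 * q - 2 * t * (?u \<bullet> ?u)"
      using assms(3) symmetric_dot_matrix[OF sym, of v ?u]
      by (simp add: matrix_vector_mult_diff_distrib matrix_vector_mult_scaleR
          inner_diff_left inner_diff_right q_def power2_eq_square algebra_simps)
    then show ?thesis using psd[of "v - t *\<^sub>R ?u"] by simp
  qed
  \<comment> \<open>The \<open>+ 1\<close> keeps the denominator positive when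
    \<open>q = 0\<close>.\<close>
  define t where "t = (?u \<bullet> ?u) / (q + 1)"
  have "t > 0" using pos \<open>q \<ge> 0\<close> by (simp add: t_def)
  then have "2 * (?u \<bullet> ?u) \<le> t * q"
    using form[of t] by (simp add: power2_eq_square)
  also have "\<dots> \<le> t * (q + 1)" using \<open>t > 0\<close> by simp
  also have "\<dots> = ?u \<bullet> ?u" using \<open>q \<ge> 0\<close> by (simp add: t_def)
  finally show False using pos by simp
qed

text \<open>The form attains its minimum \<open>l\<close> on the compact unit sphere. The form of
  \<open>S - l *\<^sub>R mat 1\<close> is then nonnegative and vanishes at the minimiser, which
  therefore lies in the kernel.\<close>

lemma symmetric_min_eigenvalue:
  fixes S :: "real ^ 'n ^ 'n"
  assumes sym: "transpose S = S"
  obtains v l where "v \<noteq> 0" "S *v v = l *\<^sub>R v" "\<And>x. l * (x \<bullet> x) \<le> x \<bullet> (S *v x)"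
proof -
  have "continuous_on (sphere 0 1) (\<lambda>x. x \<bullet> (S *v x))"
    by (intro continuous_intros linear_continuous_on matrix_vector_mul_bounded_linear)
  moreover have "sphere (0 :: real ^ 'n) 1 \<noteq> {}" by simp
  ultimately obtain v where v: "v \<in> sphere 0 1"
    and vmin: "\<forall>x\<in>sphere 0 1. v \<bullet> (S *v v) \<le> x \<bullet> (S *v x)"
    using continuous_attains_inf[OF compact_sphere] by meson
  define l where "l = v \<bullet> (S *v v)"
  have low: "l * (x \<bullet> x) \<le> x \<bullet> (S *v x)" for x
  proof (cases "x = 0")
    case False
    define y where "y = (1 / norm x) *\<^sub>R x"
    have x: "x = norm x *\<^sub>R y" using False by (simp add: y_def)
    have "norm y = 1" using False by (simp add: y_def)
    then have "l \<le> y \<bullet> (S *v y)" using vmin by (simp add: l_def)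
    then have "(norm x)\<^sup>2 * l \<le> (norm x)\<^sup>2 * (y \<bullet> (S *v y))"
      by (intro mult_left_mono) auto
    also have "\<dots> = x \<bullet> (S *v x)"
      by (subst (2 3) x) (simp add: matrix_vector_mult_scaleR power2_eq_square)
    finally show ?thesis by (simp add: power2_norm_eq_inner mult.commute)
  qed simp
  define B where "B = S - l *\<^sub>R mat 1"
  have B: "B *v x = S *v x - l *\<^sub>R x" for x
    by (simp add: B_def matrix_vector_mult_diff_rdistrib scaleR_matrix_vector_assoc[symmetric])
  have "transpose B = B"
    using sym by (simp add: B_def transpose_def vec_eq_iff mat_def)
  moreover have "x \<bullet> (B *v x) \<ge> 0" for x
    using low[of x] by (simp add: B inner_diff_right)
  moreover have "v \<bullet> (B *v v) = 0"
    using v by (simp add: B inner_diff_right l_def power2_norm_eq_inner[symmetric])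
  ultimately have "B *v v = 0"
    by (rule psd_form_zero_imp_kernel)
  then have "S *v v = l *\<^sub>R v" by (simp add: B)
  moreover have "v \<noteq> 0" using v by auto
  ultimately show thesis using low that by blast
qed

text \<open>\<open>LEAST\<close> over the reals is informative only if a least element exists: the
  minimum of the form on the sphere is an eigenvalue and bounds all others from below.\<close>

lemma lambda_min_rayleigh:
  fixes S :: "real ^ 'n ^ 'n"
  assumes "transpose S = S"
  shows "lambda_min S * (x \<bullet> x) \<le> x \<bullet> (S *v x)"
proof -
  obtain v l where v: "v \<noteq> 0" "S *v v = l *\<^sub>R v"
    and low: "\<And>x. l * (x \<bullet> x) \<le> x \<bullet> (S *v x)"
    using symmetric_min_eigenvalue[OF assms] by blast
  have "lambda_min S = l"
    unfolding lambda_min_def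
  proof (rule Least_equality)
    show "\<exists>v. v \<noteq> 0 \<and> S *v v = l *\<^sub>R v" using v by blast
  next
    fix l'
    assume "\<exists>v. v \<noteq> 0 \<and> S *v v = l' *\<^sub>R v"
    then obtain u where u: "u \<noteq> 0" "S *v u = l' *\<^sub>R u" by blast
    have "l * (u \<bullet> u) \<le> l' * (u \<bullet> u)" using low[of u] u by simp
    then show "l \<le> l'" using u(1) by simp
  qed
  then show ?thesis using low by simp
qed

text \<open>\<open>matrix_inv\<close> is defined by choice, so its inverse property rests on
  invertibility, which follows from the trivial kernel.\<close>

lemma pos_def_matrix_inv:
  fixes Q :: "real ^ 'm ^ 'm"
  assumes "pos_def Q"
  shows "Q *v (matrix_inv Q *v y) = y"
proof -
  have "x = 0" if "Q *v x = 0" for x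
    using assms that unfolding pos_def_def by (metis inner_zero_right less_irrefl)
  then have "invertible Q"
    by (simp add: invertible_left_inverse matrix_left_invertible_ker)
  then have "Q ** matrix_inv Q = mat 1"
    unfolding invertible_def matrix_inv_def by (rule someI2_ex) blast
  then show ?thesis
    by (simp add: matrix_vector_mul_assoc)
qed

lemma pos_def_nonneg: "pos_def Q \<Longrightarrow> x \<bullet> (Q *v x) \<ge> 0"
  by (cases "x = 0") (auto simp: pos_def_def less_imp_le)

section \<open>The block operator \<open>M_op\<close> and its quadratic form\<close>

lemma M_op_diff: "M_op P Q A (z - w) = M_op P Q A z - M_op P Q A w"
  by (simp add: M_op_def case_prod_beta matrix_vector_mult_diff_distrib)

lemma M_op_scaleR: "M_op P Q A (c *\<^sub>R z) = c *\<^sub>R M_op P Q A z"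
  by (simp add: M_op_def case_prod_beta matrix_vector_mult_scaleR scaleR_right_distrib)

lemma M_op_symmetric:
  assumes "transpose P = P" "transpose Q = Q"
  shows "z \<bullet> M_op P Q A w = w \<bullet> M_op P Q A z"
  using symmetric_dot_matrix[OF assms(1), of "fst z" "fst w"]
    symmetric_dot_matrix[OF assms(2), of "snd z" "snd w"]
  by (simp add: M_op_def case_prod_beta inner_prod_def inner_add_right dot_transpose_matrix)

text \<open>Completing the square in \<open>y\<close>: the two sides differ by the form of
  \<open>Q\<close> at \<open>y + s\<close>, where \<open>Q *v s = A *v x\<close>.\<close>

lemma M_op_schur:
  fixes A :: "real ^ 'n ^ 'm"
  assumes "pos_def Q"
  shows "fst z \<bullet> ((P - transpose A ** matrix_inv Q ** A) *v fst z) \<le> z \<bullet> M_op P Q A z"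
proof -
  obtain x y where z: "z = (x, y)" by force
  define s where "s = matrix_inv Q *v (A *v x)"
  have Qs: "Q *v s = A *v x"
    using assms by (simp add: s_def pos_def_matrix_inv)
  have sym: "transpose Q = Q" using assms by (simp add: pos_def_def)
  have "(y + s) \<bullet> (Q *v (y + s)) = y \<bullet> (Q *v y) + 2 * (y \<bullet> (A *v x)) + s \<bullet> (A *v x)"
    using symmetric_dot_matrix[OF sym, of s y]
    by (simp add: matrix_vector_right_distrib inner_add_left inner_add_right Qs)
  moreover have "x \<bullet> ((P - transpose A ** matrix_inv Q ** A) *v x) = x \<bullet> (P *v x) - s \<bullet> (A *v x)"
    by (simp add: matrix_vector_mult_diff_rdistrib inner_diff_right s_def dot_transpose_matrix
        flip: matrix_vector_mul_assoc)
  moreover have "(y + s) \<bullet> (Q *v (y + s)) \<ge> 0"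
    using assms by (rule pos_def_nonneg)
  ultimately show ?thesis
    by (simp add: z M_op_def inner_add_right dot_transpose_matrix)
qed

lemma M_op_pos:
  assumes "pos_def Q" "pos_def (P - transpose A ** matrix_inv Q ** A)" "z \<noteq> 0"
  shows "z \<bullet> M_op P Q A z > 0"
proof (cases "fst z = 0")
  case True
  then obtain y where "z = (0, y)" "y \<noteq> 0"
    using assms(3) by (cases z) (auto simp: zero_prod_def)
  then show ?thesis
    using assms(1) by (simp add: pos_def_def M_op_def)
next
  case False
  then show ?thesis
    using assms(2) M_op_schur[OF assms(1), of z P A] unfolding pos_def_def by force
qed

text \<open>\<open>sqrt\<close> is strictly increasing on the whole real line, negative arguments
  included.\<close>

lemma M_norm_le_iff: "M_norm P Q A z \<le> M_norm P Q A w \<longleftrightarrow> z \<bullet> M_op P Q A z \<le> w \<bullet> M_op P Q A w"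
  by (simp add: M_norm_def)

section \<open>The resolvent inclusion\<close>

text \<open>The set under \<open>the_elem\<close> in \<open>T_lin\<close>, named so that existence
  and uniqueness can be stated for its elements.\<close>

definition resolvent_set :: "real ^ 'n ^ 'n \<Rightarrow> real ^ 'm ^ 'm \<Rightarrow> real ^ 'n ^ 'm \<Rightarrow> real ^ 'm \<Rightarrow> real
    \<Rightarrow> (real ^ 'n \<Rightarrow> real) \<Rightarrow> (real ^ 'n \<Rightarrow> ereal) \<Rightarrow> (real ^ 'n \<Rightarrow> real)
    \<Rightarrow> (real ^ 'n) \<times> (real ^ 'm) \<Rightarrow> ((real ^ 'n) \<times> (real ^ 'm)) set" where
  "resolvent_set P Q A b \<sigma> f g h w =
     setvalued_inverse (\<lambda>z. {M_op P Q A z + a | a. a \<in> A_op A b \<sigma> f g h z})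
       (M_op P Q A w - B_op h w)"

text \<open>Closed form of the gradient of \<open>\<phi>\<^sub>h\<close>, for differentiable
  \<open>f\<close> and \<open>h\<close>.\<close>

definition smooth_part_gradient :: "real ^ 'n ^ 'm \<Rightarrow> real ^ 'm \<Rightarrow> real
    \<Rightarrow> (real ^ 'n \<Rightarrow> real) \<Rightarrow> (real ^ 'n \<Rightarrow> real) \<Rightarrow> real ^ 'n \<Rightarrow> real ^ 'n" where
  "smooth_part_gradient A b \<sigma> f h x =
     gradient f x - gradient h x + \<sigma> *\<^sub>R (transpose A *v (A *v x - b))"

lemma GDERIV_smooth_part:
  fixes f h :: "real ^ 'n \<Rightarrow> real" and A :: "real ^ 'n ^ 'm"
  assumes "continuously_differentiable f" "continuously_differentiable h"
  shows "GDERIV (\<lambda>x. f x - h x + \<sigma> / 2 * (norm (A *v x - b))\<^sup>2) x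
    :> smooth_part_gradient A b \<sigma> f h x"
proof -
  have f: "(f has_derivative (\<lambda>y. y \<bullet> gradient f x)) (at x)"
    and h: "(h has_derivative (\<lambda>y. y \<bullet> gradient h x)) (at x)"
    using assms GDERIV_gradient unfolding continuously_differentiable_def gderiv_def by blast+
  have A: "((\<lambda>x. A *v x - b) has_derivative (\<lambda>y. A *v y)) (at x)"
    by (auto intro!: derivative_eq_intros matrix_vector_mul_bounded_linear
        bounded_linear_imp_has_derivative)
  show ?thesis
    unfolding gderiv_def power2_norm_eq_inner
    by (rule has_derivative_eq_rhs[OF has_derivative_add[OF has_derivative_diff[OF f h]
          has_derivative_mult_right[OF has_derivative_inner[OF A A]]]])
      (simp add: fun_eq_iff smooth_part_gradient_def inner_add_right inner_diff_right
        dot_transpose_matrix inner_commute algebra_simps)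
qed

text \<open>The coupling terms \<open>A\<^sup>T y\<close> of \<open>M_op\<close> and \<open>A_op\<close> cancel, so the system is block triangular.\<close>

lemma resolvent_set_iff:
  fixes x :: "real ^ 'n" and y :: "real ^ 'm"
  shows "(x, y) \<in> resolvent_set P Q A b \<sigma> f g h w \<longleftrightarrow>
     fst (M_op P Q A w) - gradient h (fst w) - P *v x - smooth_part_gradient A b \<sigma> f h x
       \<in> subdifferential g x \<and>
     Q *v y = snd (M_op P Q A w) + b - 2 *\<^sub>R (A *v x)"
proof -
  obtain w1 w2 where w: "w = (w1, w2)" by force
  let ?v = "fst (M_op P Q A w) - gradient h (fst w) - P *v x - smooth_part_gradient A b \<sigma> f h x"
  have "(x, y) \<in> resolvent_set P Q A b \<sigma> f g h w \<longleftrightarrow>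
    (\<exists>v\<in>subdifferential g x. M_op P Q A w - B_op h w = M_op P Q A (x, y) +
      (v + gradient f x - gradient h x - transpose A *v y + \<sigma> *\<^sub>R (transpose A *v (A *v x - b)),
       A *v x - b))"
    by (auto simp: resolvent_set_def setvalued_inverse_def A_op_def)
  also have "\<dots> \<longleftrightarrow> (\<exists>v\<in>subdifferential g x.
      v = ?v \<and> Q *v y = snd (M_op P Q A w) + b - 2 *\<^sub>R (A *v x))"
  proof (intro bex_cong refl)
    fix v
    have 1: "u = p + t + (v + r - s - t + q) \<longleftrightarrow> v = u - p - (r - s + q)"
      for u p t r s q :: "real ^ 'n"
      by (auto simp: algebra_simps)
    \<comment> \<open>Here \<open>p\<close> is \<open>A *v x\<close>; it occurs once in
      \<open>M_op\<close> and once in \<open>A_op\<close>, whence the factor 2.\<close>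
    have 2: "u = p + q + (p - b) \<longleftrightarrow> q = u + b - 2 *\<^sub>R p" for u p q :: "real ^ 'm"
      by (auto simp: algebra_simps scaleR_2)
    show "M_op P Q A w - B_op h w = M_op P Q A (x, y) +
        (v + gradient f x - gradient h x - transpose A *v y + \<sigma> *\<^sub>R (transpose A *v (A *v x - b)),
         A *v x - b) \<longleftrightarrow>
      v = ?v \<and> Q *v y = snd (M_op P Q A w) + b - 2 *\<^sub>R (A *v x)"
      by (simp only: w M_op_def B_op_def smooth_part_gradient_def prod.case fst_conv snd_conv
          add_Pair diff_Pair prod.inject diff_zero 1 2)
  qed
  finally show ?thesis by blast
qed

text \<open>Pair the difference of the two inclusions with \<open>z - z'\<close>: the subgradients
  of \<open>g\<close> and the smooth part contribute nonnegative terms.\<close>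

lemma resolvent_set_monotone:
  assumes g: "proper_fun g"
    and conv: "convex_on UNIV (\<lambda>x. f x - h x + \<sigma> / 2 * (norm (A *v x - b))\<^sup>2)"
    and diff: "continuously_differentiable f" "continuously_differentiable h"
    and z: "z \<in> resolvent_set P Q A b \<sigma> f g h w" and z': "z' \<in> resolvent_set P Q A b \<sigma> f g h w'"
  shows "(fst z - fst z') \<bullet> (gradient h (fst w) - gradient h (fst w'))
    \<le> (z - z') \<bullet> M_op P Q A ((w - w') - (z - z'))"
proof -
  obtain x y x' y' where zz: "z = (x, y)" "z' = (x', y')" by force
  let ?G = "smooth_part_gradient A b \<sigma> f h"
  let ?v = "\<lambda>w x. fst (M_op P Q A w) - gradient h (fst w) - P *v x - ?G x"
  have Qy: "Q *v y = snd (M_op P Q A w) + b - 2 *\<^sub>R (A *v x)"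
    "Q *v y' = snd (M_op P Q A w') + b - 2 *\<^sub>R (A *v x')"
    using z z' by (auto simp: zz resolvent_set_iff)
  have "(x - x') \<bullet> (?v w x - ?v w' x') \<ge> 0"
    using z z' by (intro subdifferential_monotone[OF g]) (auto simp: zz resolvent_set_iff)
  moreover have "(x - x') \<bullet> (?G x - ?G x') \<ge> 0"
    using conv GDERIV_smooth_part[OF diff] GDERIV_smooth_part[OF diff]
    by (rule GDERIV_convex_monotone)
  moreover have "(z - z') \<bullet> M_op P Q A ((w - w') - (z - z'))
      - (x - x') \<bullet> (gradient h (fst w) - gradient h (fst w'))
      = (x - x') \<bullet> (?v w x - ?v w' x') + (x - x') \<bullet> (?G x - ?G x')"
  proof -
    have S: "snd (M_op P Q A ((w - w') - (z - z'))) = A *v (x - x')"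
      by (simp add: M_op_diff) (simp add: M_op_def zz Qy matrix_vector_mult_diff_distrib algebra_simps scaleR_2)
    have F: "fst (M_op P Q A ((w - w') - (z - z'))) =
        (?v w x - ?v w' x') + (?G x - ?G x') + (gradient h (fst w) - gradient h (fst w'))
        - transpose A *v (y - y')"
      by (simp add: M_op_diff) (simp add: M_op_def zz matrix_vector_mult_diff_distrib)
    \<comment> \<open>The coupling through \<open>A\<close> is skew, so its two contributions
      cancel.\<close>
    have "s \<bullet> (p + q + r - transpose A *v t) + t \<bullet> (A *v s) - s \<bullet> r = s \<bullet> p + s \<bullet> q" for p q r s t
      by (simp add: inner_add_right inner_diff_right dot_transpose_matrix)
    then show ?thesis
      unfolding inner_prod_def F S by (simp only: zz fst_diff snd_diff fst_conv snd_conv)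
  qed
  ultimately show ?thesis by (simp add: zz)
qed

text \<open>Completing the smooth part by half the form of \<open>P\<close> and a linear term gives
  \<open>\<psi>\<close>; the inclusion for \<open>x\<close> is the optimality condition of
  \<open>g + \<psi>\<close>.\<close>

lemma resolvent_set_nonempty:
  fixes A :: "real ^ 'n ^ 'm" and Q :: "real ^ 'm ^ 'm"
  assumes g: "proper_fun g" "closed_fun g" "convex_fun g"
    and conv: "convex_on UNIV (\<lambda>x. f x - h x + \<sigma> / 2 * (norm (A *v x - b))\<^sup>2)"
    and diff: "continuously_differentiable f" "continuously_differentiable h"
    and P: "transpose P = P" and Q: "pos_def Q"
    and "c > 0" and coercive: "\<And>x. c * (x \<bullet> x) \<le> x \<bullet> (P *v x)"
  shows "\<exists>z. z \<in> resolvent_set P Q A b \<sigma> f g h w"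
proof -
  let ?G = "smooth_part_gradient A b \<sigma> f h"
  define \<phi> where "\<phi> x = f x - h x + \<sigma> / 2 * (norm (A *v x - b))\<^sup>2" for x
  define u where "u = fst (M_op P Q A w) - gradient h (fst w)"
  define \<psi> where "\<psi> x = \<phi> x + (1 / 2) * (x \<bullet> (P *v x)) - x \<bullet> u" for x
  have \<phi>': "GDERIV \<phi> x :> ?G x" for x
    unfolding \<phi>_def using GDERIV_smooth_part[OF diff] .
  have \<psi>': "GDERIV \<psi> x :> ?G x + P *v x - u" for x
  proof -
    have \<phi>x: "(\<phi> has_derivative (\<lambda>y. y \<bullet> ?G x)) (at x)"
      using \<phi>' by (simp add: gderiv_def)
    have Px: "((\<lambda>x. P *v x) has_derivative (\<lambda>y. P *v y)) (at x)"
      by (intro matrix_vector_mul_bounded_linear bounded_linear_imp_has_derivative)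
    show ?thesis
      unfolding gderiv_def \<psi>_def
      by (rule has_derivative_eq_rhs[OF has_derivative_diff[OF has_derivative_add[OF \<phi>x
            has_derivative_mult_right[OF has_derivative_inner[OF has_derivative_ident Px]]]
            has_derivative_inner_left[OF has_derivative_ident]]])
        (simp add: fun_eq_iff inner_add_right inner_diff_right symmetric_dot_matrix[OF P, of x]
          algebra_simps)
  qed
  have "convex_on UNIV \<phi>" unfolding \<phi>_def using conv .
  note tangent = convex_on_GDERIV_above_tangent[OF this \<phi>'[of 0]]
  \<comment> \<open>The tangent of \<open>\<phi>\<close> at 0 supplies the affine part, half the
    form of \<open>P\<close> the quadratic one.\<close>
  have "c / 2 * (x \<bullet> x) + (?G 0 - u) \<bullet> x + \<phi> 0 \<le> \<psi> x" for x
    using coercive[of x] tangent[of x] by (simp add: \<psi>_def inner_diff_left inner_commute algebra_simps)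
  then obtain x where x: "- (?G x + P *v x - u) \<in> subdifferential g x"
    using subdifferential_inclusion_solvable[OF g \<psi>', of "c / 2"] \<open>c > 0\<close> by fastforce
  define y where "y = matrix_inv Q *v (snd (M_op P Q A w) + b - 2 *\<^sub>R (A *v x))"
  have "(x, y) \<in> resolvent_set P Q A b \<sigma> f g h w"
    using x by (simp add: resolvent_set_iff y_def pos_def_matrix_inv[OF Q] u_def algebra_simps)
  then show ?thesis by blast
qed

theorem theorem2:
  fixes A :: "real ^ 'n ^ 'm" and b :: "real ^ 'm" and \<sigma> :: real
    and P :: "real ^ 'n ^ 'n" and Q :: "real ^ 'm ^ 'm"
    and f h :: "real ^ 'n \<Rightarrow> real" and g :: "real ^ 'n \<Rightarrow> ereal"
    and L\<^sub>h \<mu>\<^sub>x \<gamma> :: real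
  assumes "\<sigma> \<ge> 0"
    and "convex_on UNIV f" and "continuously_differentiable f"
    and "\<exists>L. L-lipschitz_on UNIV (gradient f)"
    and "proper_fun g" and "closed_fun g" and "convex_fun g"
    and "transpose P = P" and "transpose Q = Q"
    and "convex_on UNIV h" and "continuously_differentiable h"
    and "L\<^sub>h-lipschitz_on UNIV (gradient h)"
    and "convex_on UNIV (\<lambda>x. f x - h x + \<sigma> / 2 * (norm (A *v x - b))\<^sup>2)"
    and "pos_def Q"
    and "pos_def (P - transpose A ** matrix_inv Q ** A)"
    and "\<mu>\<^sub>x = lambda_min (P - transpose A ** matrix_inv Q ** A)"
    and "\<mu>\<^sub>x > L\<^sub>h / 2"
    and "-1 < \<gamma>" and "\<gamma> \<le> 1 - L\<^sub>h / (2 * \<mu>\<^sub>x)"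
  shows "\<forall>w w'. M_norm P Q A (S_relaxed \<gamma> P Q A b \<sigma> f g h w - S_relaxed \<gamma> P Q A b \<sigma> f g h w')
           \<le> M_norm P Q A (w - w')"
proof (intro allI)
  fix w w' :: "(real ^ 'n) \<times> (real ^ 'm)"
  let ?S = "P - transpose A ** matrix_inv Q ** A"
  let ?M = "M_op P Q A"
  let ?T = "T_lin P Q A b \<sigma> f g h"
  have L: "L\<^sub>h \<ge> 0"
    using assms(12) by (rule lipschitz_on_nonneg)
  then have \<mu>: "\<mu>\<^sub>x > 0"
    using assms(17) by simp
  have schur: "\<mu>\<^sub>x * (fst z \<bullet> fst z) \<le> z \<bullet> ?M z" for z
    using lambda_min_rayleigh[of ?S "fst z"] M_op_schur[OF assms(14), of z P A] assms(15,16)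
    by (simp add: pos_def_def)
  have coercive: "\<mu>\<^sub>x * (x \<bullet> x) \<le> x \<bullet> (P *v x)" for x
    using schur[of "(x, 0)"] by (simp add: M_op_def)
  have mono: "(fst z - fst z') \<bullet> (gradient h (fst w) - gradient h (fst w'))
      \<le> (z - z') \<bullet> ?M ((w - w') - (z - z'))"
    if "z \<in> resolvent_set P Q A b \<sigma> f g h w" "z' \<in> resolvent_set P Q A b \<sigma> f g h w'" for z z' w w'
    using that by (rule resolvent_set_monotone[OF assms(5,13,3,11)])
  have T: "?T w \<in> resolvent_set P Q A b \<sigma> f g h w" for w
  proof -
    obtain z where z: "z \<in> resolvent_set P Q A b \<sigma> f g h w"
      using resolvent_set_nonempty[OF assms(5,6,7,13,3,11,8,14) \<mu> coercive] by blast
    \<comment> \<open>For equal inputs the left side of \<open>mono\<close> is zero, so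
      \<open>(z' - z) \<bullet> ?M (z' - z)\<close> cannot be positive.\<close>
    have "z' = z" if "z' \<in> resolvent_set P Q A b \<sigma> f g h w" for z'
    proof (rule ccontr)
      assume "z' \<noteq> z"
      then have "(z' - z) \<bullet> ?M (z' - z) > 0"
        by (intro M_op_pos assms(14,15)) simp
      moreover have "?M (- (z' - z)) = - ?M (z' - z)"
        using M_op_scaleR[of P Q A "- 1" "z' - z"] by simp
      ultimately show False
        using mono[OF that z] by simp
    qed
    then have "resolvent_set P Q A b \<sigma> f g h w = {z}"
      using z by blast
    then show ?thesis
      unfolding T_lin_def resolvent_set_def[symmetric] by simp
  qed
  define d where "d = w - w'"
  define e where "e = d - (?T w - ?T w')"
  \<comment> \<open>With perturbation \<open>fst e\<close>, the first factor on the right is the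
    first component of \<open>?T w - ?T w'\<close>, as in \<open>mono\<close>.\<close>
  have "- (L\<^sub>h / 4) * (fst e \<bullet> fst e)
      \<le> (fst w - fst w' - fst e) \<bullet> (gradient h (fst w) - gradient h (fst w'))"
    using assms(11,12)
    by (intro lipschitz_gradient_perturbed_monotone[OF assms(10)] GDERIV_gradient)
      (auto simp: continuously_differentiable_def)
  also have "\<dots> \<le> (d - e) \<bullet> ?M e"
    using mono[OF T[of w] T[of w']] by (simp add: d_def e_def)
  finally have "- (L\<^sub>h / 4) * (fst e \<bullet> fst e) + e \<bullet> ?M e \<le> d \<bullet> ?M e"
    by (simp add: inner_diff_left)
  moreover have "L\<^sub>h / 4 * (fst e \<bullet> fst e) \<le> L\<^sub>h / (4 * \<mu>\<^sub>x) * (e \<bullet> ?M e)"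
    using mult_left_mono[OF schur[of e], of "L\<^sub>h / (4 * \<mu>\<^sub>x)"] L \<mu> by simp
  ultimately have "(2 - L\<^sub>h / (2 * \<mu>\<^sub>x)) * (e \<bullet> ?M e) \<le> 2 * (d \<bullet> ?M e)"
    by (simp add: algebra_simps)
  moreover have "e \<bullet> ?M e \<ge> 0"
    by (rule order_trans[OF _ schur]) (simp add: \<mu> less_imp_le)
  \<comment> \<open>The upper bound on \<open>\<gamma>\<close> enters as
    \<open>1 + \<gamma> \<le> 2 - L\<^sub>h / (2 * \<mu>\<^sub>x)\<close>.\<close>
  then have "(1 + \<gamma>) * (e \<bullet> ?M e) \<le> (2 - L\<^sub>h / (2 * \<mu>\<^sub>x)) * (e \<bullet> ?M e)"
    using assms(19) by (intro mult_right_mono) auto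
  \<comment> \<open>The further factor \<open>1 + \<gamma>\<close>, positive by the lower bound on
    \<open>\<gamma>\<close>, makes this say that the last two terms of the expansion below have sum
    at most 0.\<close>
  ultimately have "(1 + \<gamma>) * ((1 + \<gamma>) * (e \<bullet> ?M e)) \<le> (1 + \<gamma>) * (2 * (d \<bullet> ?M e))"
    using assms(18) by (intro mult_left_mono) auto
  moreover have "(d - (1 + \<gamma>) *\<^sub>R e) \<bullet> ?M (d - (1 + \<gamma>) *\<^sub>R e)
      = d \<bullet> ?M d - (1 + \<gamma>) * (2 * (d \<bullet> ?M e)) + (1 + \<gamma>) * ((1 + \<gamma>) * (e \<bullet> ?M e))"
    using M_op_symmetric[OF assms(8,9), where A = A and z = e and w = d]
    by (simp only: M_op_diff M_op_scaleR inner_diff_left inner_diff_right inner_scaleR_left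
        inner_scaleR_right) (simp only: algebra_simps)
  moreover have "S_relaxed \<gamma> P Q A b \<sigma> f g h w - S_relaxed \<gamma> P Q A b \<sigma> f g h w'
      = d - (1 + \<gamma>) *\<^sub>R e"
    by (simp add: S_relaxed_def d_def e_def algebra_simps)
  ultimately show "M_norm P Q A (S_relaxed \<gamma> P Q A b \<sigma> f g h w - S_relaxed \<gamma> P Q A b \<sigma> f g h w')
      \<le> M_norm P Q A (w - w')"
    by (simp add: M_norm_le_iff flip: d_def)
qed

end
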